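(* Let $X$ be a locally compact Polish space, $\sigma$ a non-atomic Radon measure on $X$, $Y\in\mathcal B(X)$, and $\alpha:Y\to(0,1)$, $\beta:Y\to\mathbb R_+$ measurable functions with $\beta\in L^1_{\mathrm{loc}}(Y,\sigma)$. Let $\epsilon\in(0,1)$ and let $g:Y\times[\epsilon,\infty)\to\mathbb R_+$ be a (strictly positive) measurable function with $\int_A\int_\epsilon^\infty\frac{g(x,s)}{s}\,ds\,d\sigma(x)<\infty$ for all $A\in\mathcal B_0(Y)$. Define $$l(x,s)=\begin{cases}\beta(x)s^{1-\alpha(x)},&x\in Y,\ s\in(0,\epsilon),\\ g(x,s),&x\in Y,\ s\in[\epsilon,\infty),\\ 0,&x\notin Y,\ s\in\mathbb R_+.\end{cases}$$ Then the measure $dm(x,s)=\frac{l(x,s)}{s}\,d\sigma(x)\,ds$ satisfies the following conditions: (1) for each $x\in X$, either $l(x,s)>0$ for all $s\in\mathbb R_+$ (this holds exactly for $x\in Y$) or $l(x,s)=0$ for all $s\in\mathbb R_+$; and $\int_{A\times\mathbb R_+}l(x,s)\min\{s^{-1},1\}\,d\sigma(x)\,ds<\infty$ for all $A\in\mathcal B_0(Y)$; (2) there exist $\epsilon'>0$ and functions $l_1,l_2$ such that $l(x,s)=l_1(x,s)+l_2(x,s)$ for $x\in Y$, $s\in(0,\epsilon')$, where for each fixed $x\in Y$ the function $l_1(x,\cdot)$ is differentiable on $(0,\epsilon')$, and for each $n\in\mathbb N$ and $A\in\mathcal B_0(Y)$, $$\int_A\int_{(0,\frac{\epsilon'}n)}\sup_{u\in[\frac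 sn,sn]}\left|\frac{\partial}{\partial u}l_1(x,u)\right|ds\,d\sigma(x)<\infty,\qquad\int_A\int_{(0,\epsilon')}\frac{|l_2(x,s)|}{s}\,ds\,d\sigma(x)<\infty.$$
   Context: $\mathbb R_+=(0,\infty)$. $\mathcal B(X)$ is the Borel $\sigma$-algebra of $X$, $\mathcal B_0(X)$ is the collection of sets in $\mathcal B(X)$ with compact closure, and $\mathcal B_0(Y)$ is the collection of all $A\in\mathcal B_0(X)$ with $A\subset Y$. $L^1_{\mathrm{loc}}(Y,\sigma)$ is the space of measurable $f:Y\to\mathbb R$ with $\int_A|f|\,d\sigma<\infty$ for each $A\in\mathcal B_0(Y)$. *)

theory Defs
  imports "HOL-Analysis.Analysis"
begin

text \<open>The classical definition of a Radon measure on a locally compact space. (If the space is in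
  addition Polish, the inner regularity clause follows from the other two.)\<close>

definition radon_measure :: "'a::topological_space measure \<Rightarrow> bool" where
  "radon_measure \<sigma> \<longleftrightarrow>
     sets \<sigma> = sets borel \<and>
     (\<forall>K. compact K \<and> K \<in> sets borel \<longrightarrow> emeasure \<sigma> K < \<infinity>) \<and>
     (\<forall>A\<in>sets borel. emeasure \<sigma> A = (SUP K\<in>{K. K \<subseteq> A \<and> compact K \<and> K \<in> sets borel}. emeasure \<sigma> K))"

definition measure_atom :: "'a measure \<Rightarrow> 'a set \<Rightarrow> bool" where
  "measure_atom M A \<longleftrightarrow>
     A \<in> sets M \<and> emeasure M A > 0 \<and>
     (\<forall>B\<in>sets M. B \<subseteq> A \<and> emeasure M B < emeasure M A \<longrightarrow> emeasure M B = 0)"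

definition non_atomic :: "'a measure \<Rightarrow> bool" where
  "non_atomic M \<longleftrightarrow> (\<nexists>A. measure_atom M A)"

definition borel_rc :: "'a::topological_space set set" where
  "borel_rc = {A \<in> sets borel. compact (closure A)}"

definition borel_rc_in :: "'a::topological_space set \<Rightarrow> 'a set set" where
  "borel_rc_in Y = {A \<in> borel_rc. A \<subseteq> Y}"

text \<open>Functions on \<open>Y\<close> are represented by total functions whose values off \<open>Y\<close> are irrelevant.\<close>

definition L1_loc :: "'a::topological_space set \<Rightarrow> 'a measure \<Rightarrow> ('a \<Rightarrow> real) set" where
  "L1_loc Y \<sigma> =
     {f. f \<in> borel_measurable (restrict_space borel Y) \<and>
         (\<forall>A\<in>borel_rc_in Y. (\<integral>\<^sup>+x\<in>A. ennreal \<bar>f x\<bar> \<partial>\<sigma>) < \<infinity>)}"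

text \<open>The measure \<open>m\<close> on \<open>X \<times> (0,\<infinity>)\<close> has the form \<open>dm(x,s) = l(x,s)/s d\<sigma>(x) ds\<close>. Measurability and
  nonnegativity of \<open>l\<close> are required, since \<^const>\<open>density\<close> is only meaningful for measurable
  functions and \<^const>\<open>ennreal\<close> truncates negative values.\<close>

definition has_density_over_length ::
  "('a::topological_space \<times> real) measure \<Rightarrow> 'a measure \<Rightarrow> ('a \<Rightarrow> real \<Rightarrow> real) \<Rightarrow> bool" where
  "has_density_over_length m \<sigma> l \<longleftrightarrow>
     case_prod l \<in> borel_measurable (\<sigma> \<Otimes>\<^sub>M restrict_space lborel {0<..}) \<and>
     (\<forall>x. \<forall>s>0. 0 \<le> l x s) \<and>
     m = density (\<sigma> \<Otimes>\<^sub>M restrict_space lborel {0<..}) (\<lambda>(x, s). ennreal (l x s / s))"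

definition positivity_condition ::
  "'a::topological_space measure \<Rightarrow> 'a set \<Rightarrow> ('a \<Rightarrow> real \<Rightarrow> real) \<Rightarrow> bool" where
  "positivity_condition \<sigma> Y l \<longleftrightarrow>
     (\<forall>x. (\<forall>s>0. l x s > 0) \<or> (\<forall>s>0. l x s = 0)) \<and>
     (\<forall>x. (\<forall>s>0. l x s > 0) \<longleftrightarrow> x \<in> Y) \<and>
     (\<forall>A\<in>borel_rc_in Y.
        (\<integral>\<^sup>+(x, s)\<in>A \<times> {0<..}. ennreal (l x s * min (1 / s) 1) \<partial>(\<sigma> \<Otimes>\<^sub>M lborel)) < \<infinity>)"

text \<open>The \<^const>\<open>nn_integral\<close> of a non-measurable function is only a lower integral, so the
  measurability implicit in the finiteness of the integrals is stated explicitly. The supremum is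
  taken in \<^typ>\<open>ennreal\<close>, hence is \<open>\<infinity>\<close> for an unbounded derivative.\<close>

definition regularity_condition ::
  "'a::topological_space measure \<Rightarrow> 'a set \<Rightarrow> ('a \<Rightarrow> real \<Rightarrow> real) \<Rightarrow> bool" where
  "regularity_condition \<sigma> Y l \<longleftrightarrow>
     (\<exists>\<epsilon>>0. \<exists>l1 l2.
        case_prod l1 \<in> borel_measurable (restrict_space \<sigma> Y \<Otimes>\<^sub>M restrict_space lborel {0<..<\<epsilon>}) \<and>
        case_prod l2 \<in> borel_measurable (restrict_space \<sigma> Y \<Otimes>\<^sub>M restrict_space lborel {0<..<\<epsilon>}) \<and>
        (\<forall>x\<in>Y. \<forall>s\<in>{0<..<\<epsilon>}. l x s = l1 x s + l2 x s) \<and>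
        (\<forall>x\<in>Y. \<forall>s\<in>{0<..<\<epsilon>}. l1 x differentiable (at s)) \<and>
        (\<forall>n::nat. n \<ge> 1 \<longrightarrow>
           (\<lambda>(x, s). SUP u\<in>{s / n..s * n}. ennreal \<bar>deriv (l1 x) u\<bar>)
             \<in> borel_measurable (restrict_space \<sigma> Y \<Otimes>\<^sub>M restrict_space lborel {0<..<\<epsilon> / n})) \<and>
        (\<forall>n::nat. n \<ge> 1 \<longrightarrow> (\<forall>A\<in>borel_rc_in Y.
           (\<integral>\<^sup>+x\<in>A. (\<integral>\<^sup>+s\<in>{0<..<\<epsilon> / n}.
              (SUP u\<in>{s / n..s * n}. ennreal \<bar>deriv (l1 x) u\<bar>) \<partial>lborel) \<partial>\<sigma>) < \<infinity>)) \<and>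
        (\<forall>A\<in>borel_rc_in Y.
           (\<integral>\<^sup>+x\<in>A. (\<integral>\<^sup>+s\<in>{0<..<\<epsilon>}. ennreal (\<bar>l2 x s\<bar> / s) \<partial>lborel) \<partial>\<sigma>) < \<infinity>))"

end

theory Submission
  imports Defs
begin

text \<open>
  The decomposition in the regularity condition is the trivial one: \<open>l\<^sub>1 x s = \<beta> x * s powr (1 - \<alpha> x)\<close>
  and \<open>l\<^sub>2 = 0\<close>, with \<open>\<epsilon>' = \<epsilon>\<close>. Everything then rests on one power integral. The derivative
  \<open>\<beta> x * (1 - \<alpha> x) * u powr (- \<alpha> x)\<close> is decreasing in \<open>u\<close>, so its supremum over
  \<open>[s/n, sn]\<close> is the value at \<open>s/n\<close>, an explicit (and hence measurable) function
  (\<open>SUP_deriv_powr\<close>). The exponent \<open>-\<alpha>(x)\<close> approaches the non-integrable exponent \<open>-1\<close> as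
  \<open>\<alpha>(x)\<close> approaches 1, and no lower bound on \<open>1 - \<alpha>\<close> is available; but the factor
  \<open>1 / (1 - \<alpha>(x))\<close> that integration over \<open>s\<close> produces cancels the factor \<open>1 - \<alpha>(x)\<close> that
  differentiation produced. What remains is at most \<open>n \<beta>(x)\<close> (\<open>nn_integral_SUP_deriv_powr_le\<close>), which
  is integrable over relatively compact subsets of \<open>Y\<close>.

  For the integral in the positivity condition, Tonelli's theorem reduces the claim to a bound on the
  inner integral: since \<open>\<epsilon> < 1\<close>, the integrand is at most \<open>\<beta>(x)\<close> on \<open>(0,\<epsilon>)\<close>, and it is at
  most \<open>g(x,s)/s\<close> on \<open>[\<epsilon>,\<infinity>)\<close>.

  Since \<open>\<alpha>\<close>, \<open>\<beta>\<close> and \<open>g\<close> are measurable only on their domains, they are first extended by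
  zero to measurable functions on the whole space.
\<close>

section \<open>Measurability on rectangles\<close>

text \<open>
  Restriction to a subspace in either factor is the intended instance: the identity maps are then the
  inclusions, and the product of subspaces need not be identified with a subspace of the product.
\<close>

lemma measurable_pair_coarsen:
  assumes "(\<lambda>x. x) \<in> measurable M' M" and "(\<lambda>x. x) \<in> measurable N' N"
    and f: "f \<in> borel_measurable (M \<Otimes>\<^sub>M N)"
  shows "f \<in> borel_measurable (M' \<Otimes>\<^sub>M N')"
proof -
  have "(\<lambda>z. (fst z, snd z)) \<in> measurable (M' \<Otimes>\<^sub>M N') (M \<Otimes>\<^sub>M N)"
    by (intro measurable_Pair measurable_compose[OF measurable_fst assms(1)]
          measurable_compose[OF measurable_snd assms(2)])
  from measurable_compose[OF this f] show ?thesis by simp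
qed

lemma measurable_extend_zero_rectangle:
  fixes f :: "'a \<times> 'b \<Rightarrow> real"
  assumes f: "f \<in> borel_measurable (restrict_space M A \<Otimes>\<^sub>M restrict_space N B)"
    and [measurable]: "A \<in> sets M" "B \<in> sets N"
  shows "(\<lambda>z. if z \<in> A \<times> B then f z else 0) \<in> borel_measurable (M \<Otimes>\<^sub>M N)"
proof -
  let ?R = "restrict_space (M \<Otimes>\<^sub>M N) (A \<times> B)"
  have "(\<lambda>z. (fst z, snd z)) \<in> measurable ?R (restrict_space M A \<Otimes>\<^sub>M restrict_space N B)"
    by (intro measurable_Pair measurable_restrict_space2)
       (auto simp: space_restrict_space intro: measurable_restrict_space1)
  from measurable_compose[OF this f] have "f \<in> borel_measurable ?R" by simp
  then show ?thesis
    by (subst measurable_restrict_space_iff[symmetric]) auto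
qed

section \<open>The power function near zero\<close>

lemma nn_integral_powr_from_0:
  fixes a c :: real
  assumes "a < 1" and "0 \<le> c"
  shows "(\<integral>\<^sup>+s\<in>{0<..<c}. ennreal (s powr (- a)) \<partial>lborel) = ennreal (c powr (1 - a) / (1 - a))"
proof -
  have "((\<lambda>s. s powr (- a)) has_integral (c powr (1 - a) / (1 - a))) {0..c}"
    using has_integral_powr_from_0[of "- a" c] assms by (simp add: add.commute)
  then have "((\<lambda>s. s powr (- a)) has_integral (c powr (1 - a) / (1 - a))) {0<..<c}"
    by (simp add: has_integral_Icc_iff_Ioo)
  then show ?thesis
    by (intro nn_integral_has_integral_lebesgue') auto
qed

lemma DERIV_scaled_powr:
  fixes a b u :: real
  assumes "0 < u"
  shows "((\<lambda>s. b * s powr (1 - a)) has_real_derivative b * (1 - a) * u powr (- a)) (at u)"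
  using assms by (auto intro!: derivative_eq_intros)

lemma SUP_deriv_powr:
  fixes a b s :: real and n :: nat
  assumes "0 \<le> b" "0 < a" "a < 1" "0 < s" "n \<ge> 1"
  shows "(SUP u\<in>{s / n..s * n}. ennreal \<bar>deriv (\<lambda>s. b * s powr (1 - a)) u\<bar>)
           = ennreal (b * (1 - a) * (s / n) powr (- a))"
proof -
  have pos: "0 < s / n" using assms by simp
  have d: "\<bar>deriv (\<lambda>s. b * s powr (1 - a)) u\<bar> = b * (1 - a) * u powr (- a)" if "0 < u" for u
    using DERIV_imp_deriv[OF DERIV_scaled_powr[OF that, of b a]] assms by simp
  have "s / n \<le> s * n"
  proof -
    have "s / n \<le> s" using assms by (simp add: field_simps)
    also have "s \<le> s * n" using assms by simp
    finally show ?thesis .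
  qed
  moreover have "ennreal \<bar>deriv (\<lambda>s. b * s powr (1 - a)) u\<bar>
      \<le> ennreal (b * (1 - a) * (s / n) powr (- a))" if "u \<in> {s / n..s * n}" for u
  proof -
    have "u powr (- a) \<le> (s / n) powr (- a)"
      using that pos assms by (intro powr_mono2') auto
    moreover have "0 < u" using that pos by (auto intro: less_le_trans)
    ultimately show ?thesis using assms by (simp add: d ennreal_leI mult_left_mono)
  qed
  ultimately show ?thesis
    by (intro antisym SUP_least SUP_upper2[of "s / n"]) (auto simp: d[OF pos])
qed

text \<open>
  The exact value is \<open>b n c\<^sup>1\<^sup>-\<^sup>a\<close> for \<open>c = \<epsilon>/n\<^sup>2\<close>: the substitution \<open>s = nt\<close> gives \<open>n\<close> times
  the increment over \<open>(0,c)\<close> of the primitive \<open>b t\<^sup>1\<^sup>-\<^sup>a\<close>. As \<open>c \<le> 1\<close>, the bound \<open>b n\<close> is uniform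
  in \<open>a\<close>, which matters because \<open>a\<close> is replaced by the function \<open>\<alpha>\<close>.
\<close>

lemma nn_integral_SUP_deriv_powr_le:
  fixes a b \<epsilon> :: real and n :: nat
  assumes "0 \<le> b" "0 < a" "a < 1" "0 < \<epsilon>" "\<epsilon> < 1" "n \<ge> 1"
  shows "(\<integral>\<^sup>+s\<in>{0<..<\<epsilon> / n}.
            (SUP u\<in>{s / n..s * n}. ennreal \<bar>deriv (\<lambda>s. b * s powr (1 - a)) u\<bar>) \<partial>lborel)
          \<le> ennreal n * ennreal b"
proof -
  have "(\<integral>\<^sup>+s\<in>{0<..<\<epsilon> / n}.
            (SUP u\<in>{s / n..s * n}. ennreal \<bar>deriv (\<lambda>s. b * s powr (1 - a)) u\<bar>) \<partial>lborel)
      = (\<integral>\<^sup>+s. ennreal (b * (1 - a) * n powr a) *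
            (ennreal (s powr (- a)) * indicator {0<..<\<epsilon> / n} s) \<partial>lborel)"
  proof (intro nn_integral_cong)
    fix s :: real
    show "(SUP u\<in>{s / n..s * n}. ennreal \<bar>deriv (\<lambda>s. b * s powr (1 - a)) u\<bar>)
              * indicator {0<..<\<epsilon> / n} s
        = ennreal (b * (1 - a) * n powr a) * (ennreal (s powr (- a)) * indicator {0<..<\<epsilon> / n} s)"
    proof (cases "s \<in> {0<..<\<epsilon> / n}")
      case True
      then have s: "0 < s" by simp
      have "(s / n) powr (- a) = n powr a * s powr (- a)"
        using s assms by (simp add: powr_divide powr_minus field_simps)
      then show ?thesis
        using s assms True by (simp add: SUP_deriv_powr ennreal_mult'[symmetric] mult.assoc)
    qed simp
  qed
  also have "\<dots> = ennreal (b * (1 - a) * n powr a) * ennreal ((\<epsilon> / n) powr (1 - a) / (1 - a))"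
    using assms by (subst nn_integral_cmult) (auto simp: nn_integral_powr_from_0)
  also have "\<dots> = ennreal (b * (1 - a) * n powr a * ((\<epsilon> / n) powr (1 - a) / (1 - a)))"
    using assms by (simp add: ennreal_mult'[symmetric])
  also have "b * (1 - a) * n powr a * ((\<epsilon> / n) powr (1 - a) / (1 - a))
      = b * (n powr a * (\<epsilon> / n) powr (1 - a))"
    using assms by simp
  also have "\<dots> \<le> ennreal (n * b)"
  proof (intro ennreal_leI)
    have "\<epsilon> / n \<le> 1" using assms by (simp add: field_simps)
    then have "(\<epsilon> / n) powr (1 - a) \<le> 1" using assms by (intro powr_le1) auto
    moreover have "real n powr a \<le> n powr 1" using assms by (intro powr_mono) auto
    ultimately have "n powr a * (\<epsilon> / n) powr (1 - a) \<le> real n * 1"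
      using assms by (intro mult_mono) auto
    from mult_left_mono[OF this \<open>0 \<le> b\<close>]
    show "b * (n powr a * (\<epsilon> / n) powr (1 - a)) \<le> n * b"
      by (simp add: mult.commute)
  qed
  finally show ?thesis using assms by (simp add: ennreal_mult)
qed

section \<open>The conditions on the measure\<close>

theorem proposition28:
  fixes \<sigma> :: "'a::polish_space measure"
    and Y :: "'a set"
    and \<alpha> \<beta> :: "'a \<Rightarrow> real"
    and \<epsilon> :: real
    and g l :: "'a \<Rightarrow> real \<Rightarrow> real"
    and m :: "('a \<times> real) measure"
  assumes "locally_compact_space (euclidean :: 'a topology)"
    and "radon_measure \<sigma>"
    and "non_atomic \<sigma>"
    and "Y \<in> sets borel"
    and "\<alpha> \<in> borel_measurable (restrict_space borel Y)"
    and "\<And>x. x \<in> Y \<Longrightarrow> 0 < \<alpha> x \<and> \<alpha> x < 1"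
    and "\<And>x. x \<in> Y \<Longrightarrow> 0 < \<beta> x"
    and "\<beta> \<in> L1_loc Y \<sigma>"
    and "0 < \<epsilon>" and "\<epsilon> < 1"
    and "case_prod g \<in> borel_measurable (restrict_space borel Y \<Otimes>\<^sub>M restrict_space borel {\<epsilon>..})"
    and "\<And>x s. x \<in> Y \<Longrightarrow> \<epsilon> \<le> s \<Longrightarrow> 0 < g x s"
    and "\<And>A. A \<in> borel_rc_in Y \<Longrightarrow>
           (\<integral>\<^sup>+x\<in>A. (\<integral>\<^sup>+s\<in>{\<epsilon>..}. ennreal (g x s / s) \<partial>lborel) \<partial>\<sigma>) < \<infinity>"
    and "\<And>x s. 0 < s \<Longrightarrow>
           l x s = (if x \<in> Y then (if s < \<epsilon> then \<beta> x * s powr (1 - \<alpha> x) else g x s) else 0)"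
    and "m = density (\<sigma> \<Otimes>\<^sub>M restrict_space lborel {0<..}) (\<lambda>(x, s). ennreal (l x s / s))"
  shows "has_density_over_length m \<sigma> l \<and> positivity_condition \<sigma> Y l \<and> regularity_condition \<sigma> Y l"
proof (intro conjI)
  note Y = \<open>Y \<in> sets borel\<close>
  note \<alpha> = \<open>\<And>x. x \<in> Y \<Longrightarrow> 0 < \<alpha> x \<and> \<alpha> x < 1\<close>
  note \<beta> = \<open>\<And>x. x \<in> Y \<Longrightarrow> 0 < \<beta> x\<close>
  note \<epsilon> = \<open>0 < \<epsilon>\<close> \<open>\<epsilon> < 1\<close>
  note g = \<open>\<And>x s. x \<in> Y \<Longrightarrow> \<epsilon> \<le> s \<Longrightarrow> 0 < g x s\<close>
  note l = \<open>\<And>x s. 0 < s \<Longrightarrow>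
           l x s = (if x \<in> Y then (if s < \<epsilon> then \<beta> x * s powr (1 - \<alpha> x) else g x s) else 0)\<close>
  note g_finite = \<open>\<And>A. A \<in> borel_rc_in Y \<Longrightarrow>
           (\<integral>\<^sup>+x\<in>A. (\<integral>\<^sup>+s\<in>{\<epsilon>..}. ennreal (g x s / s) \<partial>lborel) \<partial>\<sigma>) < \<infinity>\<close>
  have \<sigma>: "sets \<sigma> = sets borel"
    using \<open>radon_measure \<sigma>\<close> by (simp add: radon_measure_def)
  have Y_\<sigma> [measurable]: "Y \<in> sets \<sigma>" using Y \<sigma> by simp
  have A_sets: "A \<in> sets \<sigma>" "A \<subseteq> Y" if "A \<in> borel_rc_in Y" for A
    using that \<sigma> by (auto simp: borel_rc_in_def borel_rc_def)
  have \<beta>_meas: "\<beta> \<in> borel_measurable (restrict_space borel Y)"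
    and \<beta>_finite: "\<And>A. A \<in> borel_rc_in Y \<Longrightarrow> (\<integral>\<^sup>+x\<in>A. ennreal \<bar>\<beta> x\<bar> \<partial>\<sigma>) < \<infinity>"
    using \<open>\<beta> \<in> L1_loc Y \<sigma>\<close> by (auto simp: L1_loc_def)
  define a where "a x = (if x \<in> Y then \<alpha> x else 0)" for x
  define b where "b x = (if x \<in> Y then \<beta> x else 0)" for x
  define h where "h z = (if z \<in> Y \<times> {\<epsilon>..} then case_prod g z else 0)" for z
  have \<sigma>_measurable: "f \<in> borel_measurable \<sigma>" if "f \<in> borel_measurable borel" for f :: "'a \<Rightarrow> real"
    using that by (simp add: measurable_cong_sets[OF \<sigma> refl])
  have a_meas [measurable]: "a \<in> borel_measurable \<sigma>"
    using \<open>\<alpha> \<in> borel_measurable (restrict_space borel Y)\<close> Y unfolding a_def[abs_def]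
    by (intro \<sigma>_measurable, subst measurable_restrict_space_iff[symmetric]) auto
  have b_meas [measurable]: "b \<in> borel_measurable \<sigma>"
    using \<beta>_meas Y unfolding b_def[abs_def]
    by (intro \<sigma>_measurable, subst measurable_restrict_space_iff[symmetric]) auto
  have h_meas [measurable]: "h \<in> borel_measurable (\<sigma> \<Otimes>\<^sub>M lborel)"
  proof -
    have "h \<in> borel_measurable (borel \<Otimes>\<^sub>M borel)"
      using measurable_extend_zero_rectangle[OF assms(11)] Y unfolding h_def[abs_def] by auto
    then show ?thesis
      by (simp add: measurable_cong_sets[OF sets_pair_measure_cong[OF \<sigma> sets_lborel] refl])
  qed
  have b_nonneg: "0 \<le> b x" for x using \<beta>[of x] by (auto simp: b_def less_imp_le)
  have h_nonneg: "0 \<le> h z" for z using g by (auto simp: h_def less_imp_le split: prod.split)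
  have a_bounds: "0 \<le> a x" "a x < 1" for x using \<alpha>[of x] by (auto simp: a_def)
  \<comment> \<open>\<open>l x s\<close> is unspecified for \<open>s \<le> 0\<close>, so it need not be measurable on the whole space;
    \<open>L\<close> is, and it agrees with \<open>l\<close> for \<open>s > 0\<close>.\<close>
  define L where "L = (\<lambda>(x, s). b x * s powr (1 - a x) * indicator {..<\<epsilon>} s + h (x, s))"
  have L_meas [measurable]: "L \<in> borel_measurable (\<sigma> \<Otimes>\<^sub>M lborel)"
    unfolding L_def by measurable
  have l_eq_L: "l x s = L (x, s)" if "0 < s" for x s
    using that by (auto simp: l L_def a_def b_def h_def)
  have l_pos: "0 < l x s" if "x \<in> Y" "0 < s" for x s
    using that \<beta>[of x] g[of x s] by (auto simp: l)
  have l_zero: "l x s = 0" if "x \<notin> Y" "0 < s" for x s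
    using that by (auto simp: l)

  show "has_density_over_length m \<sigma> l"
    unfolding has_density_over_length_def
  proof (intro conjI allI impI)
    have "L \<in> borel_measurable (\<sigma> \<Otimes>\<^sub>M restrict_space lborel {0<..})"
      by (rule measurable_pair_coarsen[OF _ _ L_meas]) (auto intro: measurable_restrict_space1)
    then show "case_prod l \<in> borel_measurable (\<sigma> \<Otimes>\<^sub>M restrict_space lborel {0<..})"
      by (subst measurable_cong[where g = L])
         (auto simp: space_pair_measure space_restrict_space l_eq_L)
    show "0 \<le> l x s" if "0 < s" for x s
      using l_pos[of x s] l_zero[of x s] that by (cases "x \<in> Y") auto
    show "m = density (\<sigma> \<Otimes>\<^sub>M restrict_space lborel {0<..}) (\<lambda>(x, s). ennreal (l x s / s))"
      by fact
  qed

  show "positivity_condition \<sigma> Y l"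
    unfolding positivity_condition_def
  proof (intro conjI ballI allI)
    fix x
    show "(\<forall>s>0. 0 < l x s) \<or> (\<forall>s>0. l x s = 0)"
      using l_pos l_zero by blast
    show "(\<forall>s>0. 0 < l x s) \<longleftrightarrow> x \<in> Y"
      using l_pos l_zero[of x 1] by (metis less_irrefl zero_less_one)
  next
    fix A assume A: "A \<in> borel_rc_in Y"
    note [measurable] = A_sets(1)[OF A]
    define f where "f = (\<lambda>(x, s). ennreal (L (x, s) * min (1 / s) 1) * indicator (A \<times> {0<..}) (x, s))"
    have f_meas: "f \<in> borel_measurable (\<sigma> \<Otimes>\<^sub>M lborel)"
      unfolding f_def by measurable
    define G where "G x = (\<integral>\<^sup>+s. ennreal (h (x, s) / s) \<partial>lborel)" for x
    have G_meas [measurable]: "G \<in> borel_measurable \<sigma>"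
      unfolding G_def by measurable
    \<comment> \<open>The interval \<open>(0,\<epsilon>)\<close> is enlarged to \<open>[0,1]\<close>, so that the first term contributes exactly
      \<open>b x\<close> to the inner integral.\<close>
    have f_le: "f (x, s) \<le> (ennreal (b x) * indicator {0..1} s + ennreal (h (x, s) / s)) * indicator A x"
      for x s
    proof (cases "x \<in> A \<and> 0 < s")
      case True
      then have s: "0 < s" by simp
      have "L (x, s) * min (1 / s) 1 \<le> b x * indicator {0..1} s + h (x, s) / s"
      proof (cases "s < \<epsilon>")
        case less: True
        have "b x * s powr (1 - a x) \<le> b x * 1"
          using less s \<epsilon> b_nonneg a_bounds(2)[of x] by (intro mult_left_mono powr_le1) auto
        moreover have "min (1 / s) 1 = 1" using less s \<epsilon> by (simp add: min_def field_simps)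
        ultimately show ?thesis using less s \<epsilon> by (simp add: L_def h_def)
      next
        case False
        then have "L (x, s) * min (1 / s) 1 = h (x, s) * min (1 / s) 1"
          by (simp add: L_def)
        also have "\<dots> \<le> h (x, s) * (1 / s)"
          by (intro mult_left_mono h_nonneg) simp
        also have "\<dots> \<le> b x * indicator {0..1} s + h (x, s) / s"
          using b_nonneg[of x] by simp
        finally show ?thesis .
      qed
      then have "ennreal (L (x, s) * min (1 / s) 1)
          \<le> ennreal (b x * indicator {0..1} s + h (x, s) / s)"
        by (rule ennreal_leI)
      also have "\<dots> = ennreal (b x) * indicator {0..1} s + ennreal (h (x, s) / s)"
        using b_nonneg[of x] h_nonneg[of "(x, s)"] s
        by (simp add: ennreal_plus ennreal_mult ennreal_indicator)
      finally show ?thesis using True by (simp add: f_def)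
    qed (auto simp: f_def indicator_def)
    have "(\<integral>\<^sup>+(x, s)\<in>A \<times> {0<..}. ennreal (l x s * min (1 / s) 1) \<partial>(\<sigma> \<Otimes>\<^sub>M lborel))
        = (\<integral>\<^sup>+z. f z \<partial>(\<sigma> \<Otimes>\<^sub>M lborel))"
      by (intro nn_integral_cong) (auto simp: f_def l_eq_L indicator_def split: prod.split)
    also have "\<dots> = (\<integral>\<^sup>+x. \<integral>\<^sup>+s. f (x, s) \<partial>lborel \<partial>\<sigma>)"
      by (rule lborel.nn_integral_fst[OF f_meas, symmetric])
    also have "\<dots> \<le> (\<integral>\<^sup>+x. (ennreal (b x) + G x) * indicator A x \<partial>\<sigma>)"
    proof (intro nn_integral_mono)
      fix x assume "x \<in> space \<sigma>"
      then have [measurable]: "(\<lambda>s. h (x, s)) \<in> borel_measurable lborel" by measurable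
      have "(\<integral>\<^sup>+s. f (x, s) \<partial>lborel) \<le> (\<integral>\<^sup>+s. (ennreal (b x) * indicator {0..1} s
          + ennreal (h (x, s) / s)) * indicator A x \<partial>lborel)"
        by (intro nn_integral_mono f_le)
      also have "\<dots> = (ennreal (b x) + G x) * indicator A x"
        unfolding G_def
        by (subst nn_integral_multc, measurable, subst nn_integral_add)
           (auto simp: nn_integral_cmult_indicator)
      finally show "(\<integral>\<^sup>+s. f (x, s) \<partial>lborel) \<le> (ennreal (b x) + G x) * indicator A x" .
    qed
    also have "\<dots> = (\<integral>\<^sup>+x\<in>A. ennreal (b x) \<partial>\<sigma>) + (\<integral>\<^sup>+x\<in>A. G x \<partial>\<sigma>)"
      by (simp add: distrib_right nn_integral_add)
    also have "(\<integral>\<^sup>+x\<in>A. ennreal (b x) \<partial>\<sigma>) = (\<integral>\<^sup>+x\<in>A. ennreal \<bar>\<beta> x\<bar> \<partial>\<sigma>)"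
      using A_sets(2)[OF A] \<beta>
      by (intro nn_integral_cong) (auto simp: b_def less_imp_le split: split_indicator)
    also have "(\<integral>\<^sup>+x\<in>A. G x \<partial>\<sigma>)
        = (\<integral>\<^sup>+x\<in>A. (\<integral>\<^sup>+s\<in>{\<epsilon>..}. ennreal (g x s / s) \<partial>lborel) \<partial>\<sigma>)"
    proof (intro nn_integral_cong)
      fix x
      have "G x = (\<integral>\<^sup>+s\<in>{\<epsilon>..}. ennreal (g x s / s) \<partial>lborel)" if "x \<in> A"
        unfolding G_def using that A_sets(2)[OF A]
        by (intro nn_integral_cong) (auto simp: h_def split: split_indicator)
      then show "G x * indicator A x
          = (\<integral>\<^sup>+s\<in>{\<epsilon>..}. ennreal (g x s / s) \<partial>lborel) * indicator A x"
        by (auto split: split_indicator)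
    qed
    also have "(\<integral>\<^sup>+x\<in>A. ennreal \<bar>\<beta> x\<bar> \<partial>\<sigma>)
        + (\<integral>\<^sup>+x\<in>A. (\<integral>\<^sup>+s\<in>{\<epsilon>..}. ennreal (g x s / s) \<partial>lborel) \<partial>\<sigma>) < \<infinity>"
      using \<beta>_finite[OF A] g_finite[OF A] by (simp add: less_top)
    finally show "(\<integral>\<^sup>+(x, s)\<in>A \<times> {0<..}. ennreal (l x s * min (1 / s) 1)
        \<partial>(\<sigma> \<Otimes>\<^sub>M lborel)) < \<infinity>" .
  qed

  define l1 where "l1 x s = \<beta> x * s powr (1 - \<alpha> x)" for x s
  have SUP_l1: "(SUP u\<in>{s / n..s * n}. ennreal \<bar>deriv (l1 x) u\<bar>)
      = ennreal (b x * (1 - a x) * (s / n) powr (- a x))"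
    if "x \<in> Y" "0 < s" "n \<ge> 1" for x and s :: real and n :: nat
    using that \<alpha>[of x] \<beta>[of x] SUP_deriv_powr[of "\<beta> x" "\<alpha> x" s n]
    by (simp add: l1_def[abs_def] a_def b_def)
  have restrict_meas: "f \<in> borel_measurable (restrict_space \<sigma> Y \<Otimes>\<^sub>M restrict_space lborel B)"
    if "f \<in> borel_measurable (\<sigma> \<Otimes>\<^sub>M lborel)" for f :: "'a \<times> real \<Rightarrow> 'c::topological_space" and B
    by (rule measurable_pair_coarsen[OF _ _ that]) (auto intro: measurable_restrict_space1)
  show "regularity_condition \<sigma> Y l"
    unfolding regularity_condition_def
  proof (rule exI[of _ \<epsilon>], intro conjI, fact, rule exI[of _ l1], rule exI[of _ "\<lambda>x s. 0"],
      intro conjI allI ballI impI)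
    have "(\<lambda>(x, s). b x * s powr (1 - a x))
        \<in> borel_measurable (restrict_space \<sigma> Y \<Otimes>\<^sub>M restrict_space lborel {0<..<\<epsilon>})"
      by (rule restrict_meas) measurable
    then show "case_prod l1 \<in> borel_measurable (restrict_space \<sigma> Y \<Otimes>\<^sub>M restrict_space lborel {0<..<\<epsilon>})"
      by (subst measurable_cong[where g = "\<lambda>(x, s). b x * s powr (1 - a x)"])
         (auto simp: space_pair_measure space_restrict_space l1_def a_def b_def)
    show "(\<lambda>(x, s). 0::real) \<in> borel_measurable (restrict_space \<sigma> Y \<Otimes>\<^sub>M restrict_space lborel {0<..<\<epsilon>})"
      by simp
  next
    fix x s assume "x \<in> Y" "s \<in> {0<..<\<epsilon>}"
    then show "l x s = l1 x s + 0" by (simp add: l l1_def)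
    show "l1 x differentiable at s"
      unfolding l1_def[abs_def]
      using \<open>s \<in> {0<..<\<epsilon>}\<close> DERIV_scaled_powr[of s "\<beta> x" "\<alpha> x"] real_differentiable_def by auto
  next
    fix n :: nat assume "real n \<ge> 1"
    then have n: "n \<ge> 1" by simp
    have "(\<lambda>(x, s). ennreal (b x * (1 - a x) * (s / n) powr (- a x)))
        \<in> borel_measurable (restrict_space \<sigma> Y \<Otimes>\<^sub>M restrict_space lborel {0<..<\<epsilon> / n})"
      by (rule restrict_meas) measurable
    then show "(\<lambda>(x, s :: real). SUP u\<in>{s / n..s * n}. ennreal \<bar>deriv (l1 x) u\<bar>)
        \<in> borel_measurable (restrict_space \<sigma> Y \<Otimes>\<^sub>M restrict_space lborel {0<..<\<epsilon> / n})"
      by (subst measurable_cong[where g = "\<lambda>(x, s). ennreal (b x * (1 - a x) * (s / n) powr (- a x))"])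
         (use n in \<open>auto simp: space_pair_measure space_restrict_space intro!: SUP_l1\<close>)
    fix A assume A: "A \<in> borel_rc_in Y"
    note [measurable] = A_sets(1)[OF A]
    have "(\<integral>\<^sup>+x\<in>A. (\<integral>\<^sup>+s\<in>{0<..<\<epsilon> / n}.
              (SUP u\<in>{s / n..s * n}. ennreal \<bar>deriv (l1 x) u\<bar>) \<partial>lborel) \<partial>\<sigma>)
        \<le> (\<integral>\<^sup>+x. ennreal n * (ennreal (b x) * indicator A x) \<partial>\<sigma>)"
    proof (intro nn_integral_mono)
      fix x
      show "(\<integral>\<^sup>+s\<in>{0<..<\<epsilon> / n}. (SUP u\<in>{s / n..s * n}. ennreal \<bar>deriv (l1 x) u\<bar>) \<partial>lborel)
          * indicator A x \<le> ennreal n * (ennreal (b x) * indicator A x)"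
        using nn_integral_SUP_deriv_powr_le[of "\<beta> x" "\<alpha> x" \<epsilon> n] \<alpha>[of x] \<beta>[of x] \<epsilon> n A_sets(2)[OF A]
        by (auto simp: l1_def[abs_def] b_def split: split_indicator)
    qed
    also have "\<dots> = ennreal n * (\<integral>\<^sup>+x\<in>A. ennreal (b x) \<partial>\<sigma>)"
      by (rule nn_integral_cmult) measurable
    also have "(\<integral>\<^sup>+x\<in>A. ennreal (b x) \<partial>\<sigma>) = (\<integral>\<^sup>+x\<in>A. ennreal \<bar>\<beta> x\<bar> \<partial>\<sigma>)"
      using A_sets(2)[OF A] \<beta>
      by (intro nn_integral_cong) (auto simp: b_def less_imp_le split: split_indicator)
    also have "ennreal n * (\<integral>\<^sup>+x\<in>A. ennreal \<bar>\<beta> x\<bar> \<partial>\<sigma>) < \<infinity>"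
      using \<beta>_finite[OF A] by (simp add: ennreal_mult_less_top less_top)
    finally show "(\<integral>\<^sup>+x\<in>A. (\<integral>\<^sup>+s\<in>{0<..<\<epsilon> / n}.
              (SUP u\<in>{s / n..s * n}. ennreal \<bar>deriv (l1 x) u\<bar>) \<partial>lborel) \<partial>\<sigma>) < \<infinity>" .
  next
    fix A :: "'a set"
    show "(\<integral>\<^sup>+x\<in>A. (\<integral>\<^sup>+s\<in>{0<..<\<epsilon>}. ennreal (\<bar>0\<bar> / s) \<partial>lborel) \<partial>\<sigma>) < \<infinity>"
      by simp
  qed
qed

end
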